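(* Let $M$ be a square $\{0,1\}$-matrix with exactly $k$ diagonal entries equal to $0$ and exactly $\ell$ diagonal entries equal to $1$, and let $D$ be a minimal $M$-obstruction. If $D$ contains a pair of false twins or a pair of true twins, then $|V(D)|\le (k+1)(\ell+1)$.
   Context: Digraphs are finite, without loops and multiple arcs. A strong clique: set $C$ with both $(x,y),(y,x)$ arcs for all distinct $x,y\in C$; an independent set: set with no arcs between any two of its vertices. For disjoint $S,S'$, $S$ is completely adjacent (resp. completely non-adjacent) to $S'$ if $(x,x')$ is an arc for all (resp. no) $x\in S,x'\in S'$. An $M$-partition of $D$ ($M$ of size $k+\ell$) is a partition of $V(D)$ into possibly empty parts $V_1,\dots,V_{k+\ell}$ with $V_i$ independent if $M(i,i)=0$, a strong clique if $M(i,i)=1$, and for $i\ne j$, $V_i$ completely non-adjacent to $V_j$ if $M(i,j)=0$ and completely adjacent to $V_j$ if $M(i,j)=1$. A minimal $M$-obstruction is a digraph with no $M$-partition such that $D-v$ has an $M$-partition for every vertex $v$. For distinct vertices $u,v,w$, $w$ distinguishes $u,v$ if exactly one of $u,v$ is an in-neighbour of $w$ or exactly one is an out-neighbour of $w$; distinct $u,v$ are twins if no vertex distinguishes them; true twins if moreover both $(u,v),(v,u)$ are arcs, false twins if neither is an arc. *)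

theory Defs
  imports
    "Graph_Theory.Digraph"
    "Jordan_Normal_Form.Matrix"
    "HOL-Library.Disjoint_Sets"
begin

definition strong_clique :: "('a, 'b) pre_digraph \<Rightarrow> 'a set \<Rightarrow> bool" where
  "strong_clique D C \<longleftrightarrow> C \<subseteq> verts D \<and>
     (\<forall>x\<in>C. \<forall>y\<in>C. x \<noteq> y \<longrightarrow> x \<rightarrow>\<^bsub>D\<^esub> y \<and> y \<rightarrow>\<^bsub>D\<^esub> x)"

definition independent_set :: "('a, 'b) pre_digraph \<Rightarrow> 'a set \<Rightarrow> bool" where
  "independent_set D S \<longleftrightarrow> S \<subseteq> verts D \<and> (\<forall>x\<in>S. \<forall>y\<in>S. \<not> x \<rightarrow>\<^bsub>D\<^esub> y)"

definition completely_adjacent :: "('a, 'b) pre_digraph \<Rightarrow> 'a set \<Rightarrow> 'a set \<Rightarrow> bool" where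
  "completely_adjacent D S S' \<longleftrightarrow> (\<forall>x\<in>S. \<forall>x'\<in>S'. x \<rightarrow>\<^bsub>D\<^esub> x')"

definition completely_nonadjacent :: "('a, 'b) pre_digraph \<Rightarrow> 'a set \<Rightarrow> 'a set \<Rightarrow> bool" where
  "completely_nonadjacent D S S' \<longleftrightarrow> (\<forall>x\<in>S. \<forall>x'\<in>S'. \<not> x \<rightarrow>\<^bsub>D\<^esub> x')"

text \<open>The parts are indexed from 0 and may be empty. Since \<open>(i, j)\<close> ranges over ordered pairs,
  the entries \<open>(i, j)\<close> and \<open>(j, i)\<close> constrain the arcs in the two directions separately.\<close>

definition is_M_partition :: "nat mat \<Rightarrow> ('a, 'b) pre_digraph \<Rightarrow> (nat \<Rightarrow> 'a set) \<Rightarrow> bool" where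
  "is_M_partition M D V \<longleftrightarrow>
     disjoint_family_on V {..<dim_row M} \<and>
     (\<Union>i<dim_row M. V i) = verts D \<and>
     (\<forall>i<dim_row M.
        (M $$ (i, i) = 0 \<longrightarrow> independent_set D (V i)) \<and>
        (M $$ (i, i) = 1 \<longrightarrow> strong_clique D (V i))) \<and>
     (\<forall>i<dim_row M. \<forall>j<dim_row M. i \<noteq> j \<longrightarrow>
        (M $$ (i, j) = 0 \<longrightarrow> completely_nonadjacent D (V i) (V j)) \<and>
        (M $$ (i, j) = 1 \<longrightarrow> completely_adjacent D (V i) (V j)))"

definition has_M_partition :: "nat mat \<Rightarrow> ('a, 'b) pre_digraph \<Rightarrow> bool" where
  "has_M_partition M D \<longleftrightarrow> (\<exists>V. is_M_partition M D V)"

text \<open>The locale \<^locale>\<open>digraph\<close> consists of the finite digraphs without loops and multiple arcs.\<close>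

definition minimal_M_obstruction :: "nat mat \<Rightarrow> ('a, 'b) pre_digraph \<Rightarrow> bool" where
  "minimal_M_obstruction M D \<longleftrightarrow>
     digraph D \<and> \<not> has_M_partition M D \<and>
     (\<forall>v\<in>verts D. has_M_partition M (pre_digraph.del_vert D v))"

text \<open>Between truth values, \<open>\<noteq>\<close> is exclusive or: exactly one of the two holds.\<close>

definition distinguishes :: "('a, 'b) pre_digraph \<Rightarrow> 'a \<Rightarrow> 'a \<Rightarrow> 'a \<Rightarrow> bool" where
  "distinguishes D w u v \<longleftrightarrow>
     u \<in> verts D \<and> v \<in> verts D \<and> w \<in> verts D \<and> u \<noteq> v \<and> w \<noteq> u \<and> w \<noteq> v \<and>
     ((u \<rightarrow>\<^bsub>D\<^esub> w) \<noteq> (v \<rightarrow>\<^bsub>D\<^esub> w) \<or> (w \<rightarrow>\<^bsub>D\<^esub> u) \<noteq> (w \<rightarrow>\<^bsub>D\<^esub> v))"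

definition twins :: "('a, 'b) pre_digraph \<Rightarrow> 'a \<Rightarrow> 'a \<Rightarrow> bool" where
  "twins D u v \<longleftrightarrow>
     u \<in> verts D \<and> v \<in> verts D \<and> u \<noteq> v \<and> \<not> (\<exists>w\<in>verts D. distinguishes D w u v)"

definition true_twins :: "('a, 'b) pre_digraph \<Rightarrow> 'a \<Rightarrow> 'a \<Rightarrow> bool" where
  "true_twins D u v \<longleftrightarrow> twins D u v \<and> u \<rightarrow>\<^bsub>D\<^esub> v \<and> v \<rightarrow>\<^bsub>D\<^esub> u"

definition false_twins :: "('a, 'b) pre_digraph \<Rightarrow> 'a \<Rightarrow> 'a \<Rightarrow> bool" where
  "false_twins D u v \<longleftrightarrow> twins D u v \<and> \<not> u \<rightarrow>\<^bsub>D\<^esub> v \<and> \<not> v \<rightarrow>\<^bsub>D\<^esub> u"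

end

theory Submission
  imports Defs
begin

text \<open>
  An \<open>M\<close>-partition is a full homomorphism to the digraph whose adjacency matrix is \<open>M\<close>. Complementing
  both digraphs exchanges false with true twins and \<open>k\<close> with \<open>l\<close>, so assume there are false twins.
  Take \<open>v\<close> in a largest class \<open>F\<close> of false twins, of size \<open>m \<ge> 2\<close>, and partition \<open>D - v\<close>. The
  vertices of \<open>F - v\<close> lie in distinct clique parts. If each of them is alone in its part, every
  independent part lies in a false-twin class (size at most \<open>m\<close>), every other clique part lies in a
  true-twin class (size at most \<open>k + 1\<close>), and
  \<open>1 + k m + (m - 1) + (l - m + 1) (k + 1) = (k + 1) (l + 1)\<close>. Otherwise \<open>F = {u, v}\<close>, and \<open>u\<close> shares
  its part with a vertex \<open>c\<close>: then \<open>{u, v, c}\<close> is a module inducing a path with centre \<open>c\<close>.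

  If the bound fails, this exceptional case and its complement hold for all pairs of twins, all
  twin classes have at most two elements, and centres have no twins. A vertex other than \<open>c\<close> without
  twins would save enough in the count over \<open>D - v\<close>; without such a vertex \<open>c\<close> is the centre of
  every false-twin pair, hence adjacent to everything, and one counts over \<open>D - c\<close>.
  For \<open>k = 0\<close>, any partition of \<open>D - c\<close> has only singleton parts.
\<close>

section \<open>Full homomorphisms, twins and centres\<close>

definition full_hom :: "'i set \<Rightarrow> ('a \<Rightarrow> 'a \<Rightarrow> bool) \<Rightarrow> ('i \<Rightarrow> 'i \<Rightarrow> bool) \<Rightarrow> 'a set \<Rightarrow> ('a \<Rightarrow> 'i) \<Rightarrow> bool" where
  "full_hom I A H X f \<longleftrightarrow> f ` X \<subseteq> I \<and> (\<forall>x\<in>X. \<forall>y\<in>X. x \<noteq> y \<longrightarrow> A x y = H (f x) (f y))"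

definition loops :: "'i set \<Rightarrow> ('i \<Rightarrow> 'i \<Rightarrow> bool) \<Rightarrow> 'i set" where
  "loops I H = {i \<in> I. H i i}"

definition f_twins :: "'a set \<Rightarrow> ('a \<Rightarrow> 'a \<Rightarrow> bool) \<Rightarrow> 'a \<Rightarrow> 'a \<Rightarrow> bool" where
  "f_twins V A u v \<longleftrightarrow> u \<in> V \<and> v \<in> V \<and> u \<noteq> v \<and> \<not> A u v \<and> \<not> A v u \<and>
     (\<forall>w\<in>V - {u, v}. A u w = A v w \<and> A w u = A w v)"

definition f_class :: "'a set \<Rightarrow> ('a \<Rightarrow> 'a \<Rightarrow> bool) \<Rightarrow> 'a \<Rightarrow> 'a set" where
  "f_class V A v = insert v {w. f_twins V A v w}"

text \<open>Meant for false twins \<open>u\<close>, \<open>v\<close>: outside the triple only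
  \<open>u\<close> is compared with \<open>c\<close>, and \<open>v\<close> agrees with
  \<open>u\<close> by twinship.\<close>

definition centre :: "'a set \<Rightarrow> ('a \<Rightarrow> 'a \<Rightarrow> bool) \<Rightarrow> 'a \<Rightarrow> 'a \<Rightarrow> 'a \<Rightarrow> bool" where
  "centre V A u v c \<longleftrightarrow> c \<in> V - {u, v} \<and> A u c \<and> A c u \<and> A v c \<and> A c v \<and>
     (\<forall>w\<in>V - {u, v, c}. A u w = A c w \<and> A w u = A w c)"

text \<open>Bare relations make complementation mere negation of \<open>A\<close> and
  \<open>H\<close>, so each result on false twins also serves true twins.\<close>

locale obstruction =
  fixes V :: "'a set" and I :: "'i set" and A H
  assumes finite_V: "finite V" and finite_I: "finite I"
    and no_hom: "\<not> full_hom I A H V f"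
    and hom_minus: "v \<in> V \<Longrightarrow> \<exists>f. full_hom I A H (V - {v}) f"

text \<open>Here \<open>- A\<close> is the pointwise complement; the loops it acquires are harmless, as only pairs of distinct
  vertices are compared. So \<open>f_twins V (- A)\<close> are the true twins of \<open>A\<close>, and \<open>loops I (- H)\<close> are the
  loopless vertices of \<open>H\<close>, that is, the independent parts.\<close>

lemma full_hom_compl: "full_hom I (- A) (- H) X f \<longleftrightarrow> full_hom I A H X f"
  by (auto simp: full_hom_def)

lemma obstruction_compl: "obstruction V I A H \<Longrightarrow> obstruction V I (- A) (- H)"
  by (auto simp: obstruction_def full_hom_compl)

lemma f_twins_sym: "f_twins V A u v \<Longrightarrow> f_twins V A v u"
  by (auto simp: f_twins_def)

lemma f_twins_eq:
  assumes "f_twins V A u v" "w \<in> V" "w \<noteq> u" "w \<noteq> v"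
  shows "A u w = A v w" "A w u = A w v"
  using assms by (auto simp: f_twins_def)

lemma centre_eq:
  assumes "centre V A u v c" "w \<in> V" "w \<noteq> u" "w \<noteq> v" "w \<noteq> c"
  shows "A u w = A c w" "A w u = A w c"
  using assms by (auto simp: centre_def)

lemma full_homD: "full_hom I A H X f \<Longrightarrow> x \<in> X \<Longrightarrow> y \<in> X \<Longrightarrow> x \<noteq> y \<Longrightarrow> A x y = H (f x) (f y)"
  by (simp add: full_hom_def)

lemma f_twins_trans:
  assumes uv: "f_twins V A u v" and vw: "f_twins V A v w" and "u \<noteq> w"
  shows "f_twins V A u w"
proof -
  have V: "u \<in> V" "v \<in> V" "w \<in> V" "u \<noteq> v" "v \<noteq> w" "\<not> A u v" "\<not> A v u" "\<not> A v w" "\<not> A w v"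
    using assms by (auto simp: f_twins_def)
  then have "\<not> A u w" "\<not> A w u"
    using f_twins_eq[OF vw V(1)] assms(3) by auto
  moreover have "A u x = A w x \<and> A x u = A x w" if "x \<in> V - {u, w}" for x
    using that V f_twins_eq[OF uv, of x] f_twins_eq[OF vw, of x] by (cases "x = v") auto
  ultimately show ?thesis
    using V assms(3) by (auto simp: f_twins_def)
qed

lemma self_in_f_class: "v \<in> f_class V A v"
  by (simp add: f_class_def)

lemma f_class_subset: "v \<in> V \<Longrightarrow> f_class V A v \<subseteq> V"
  by (auto simp: f_class_def f_twins_def)

text \<open>Vertices of one part agree towards all the rest of \<open>V - {v}\<close>, so only
  \<open>v\<close> could distinguish them.\<close>

lemma same_part_f_twins:
  assumes "full_hom I A H (V - {v}) f" "x \<in> V - {v}" "y \<in> V - {v}" "x \<noteq> y" "f x = f y"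
    and "\<not> H (f x) (f x)" "v \<in> V \<Longrightarrow> A x v = A y v \<and> A v x = A v y"
  shows "f_twins V A x y"
proof -
  have "\<not> A x y" "\<not> A y x"
    using full_homD[OF assms(1), of x y] full_homD[OF assms(1), of y x] assms(2-6) by auto
  moreover have "A x w = A y w \<and> A w x = A w y" if w: "w \<in> V - {x, y}" for w
  proof (cases "w = v")
    case False
    then show ?thesis
      using full_homD[OF assms(1), of x w] full_homD[OF assms(1), of y w]
        full_homD[OF assms(1), of w x] full_homD[OF assms(1), of w y] assms(2-5) w by auto
  qed (use assms(7) w in auto)
  ultimately show ?thesis
    using assms(2-4) by (auto simp: f_twins_def)
qed

lemma same_part_t_twins:
  assumes "full_hom I A H (V - {v}) f" "x \<in> V - {v}" "y \<in> V - {v}" "x \<noteq> y" "f x = f y"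
    and "H (f x) (f x)" "v \<in> V \<Longrightarrow> A x v = A y v \<and> A v x = A v y"
  shows "f_twins V (- A) x y"
  by (rule same_part_f_twins[of I "- A" "- H" V v f]) (use assms in \<open>auto simp: full_hom_compl\<close>)

lemma card_le_sum_parts:
  assumes "finite X" "finite I" "f ` X \<subseteq> I"
  shows "card X \<le> (\<Sum>i\<in>I. card {x \<in> X. f x = i})"
proof -
  have "X = (\<Union>i\<in>I. {x \<in> X. f x = i})"
    using assms by auto
  then show ?thesis
    using card_UN_le[OF assms(2), of "\<lambda>i. {x \<in> X. f x = i}"] by simp
qed

lemma sum_le_card_mult: "(\<And>i. i \<in> S \<Longrightarrow> g i \<le> n) \<Longrightarrow> sum g S \<le> card S * (n::nat)"
  using sum_bounded_above[of S g n] by simp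

section \<open>Interaction of centres with twins\<close>

lemma centreD:
  assumes "centre V A u v c"
  shows "c \<in> V" "c \<noteq> u" "c \<noteq> v" "A u c" "A c u" "A v c" "A c v"
  using assms by (simp_all add: centre_def)

lemma f_twinsD:
  assumes "f_twins V A u v"
  shows "u \<in> V" "v \<in> V" "u \<noteq> v" "\<not> A u v" "\<not> A v u"
  using assms by (simp_all add: f_twins_def)

text \<open>A false twin \<open>d\<close> of \<open>c\<close> would be joined to \<open>u\<close> as
  \<open>c\<close> is, and then to \<open>c\<close> as \<open>u\<close> is.\<close>

lemma centre_no_f_twin:
  assumes c: "centre V A u v c" and "u \<in> V"
  shows "\<not> f_twins V A c d"
proof
  assume t: "f_twins V A c d"
  have d: "d \<noteq> u" "d \<noteq> v"
    using centreD[OF c] f_twinsD[OF t] by metis+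
  then have "A c u = A d u"
    using f_twins_eq(1)[OF t, of u] assms(2) centreD(2)[OF c] by metis
  moreover have "A d u = A d c"
    using centre_eq(2)[OF c, of d] d f_twinsD[OF t] by metis
  ultimately show False
    using centreD[OF c] f_twinsD[OF t] by metis
qed

text \<open>If \<open>c = e\<close>, the arc from \<open>u\<close> to \<open>x\<close> is present
  because \<open>x\<close> agrees with \<open>c\<close> on \<open>u\<close>, and absent because
  \<open>u\<close> agrees with \<open>c\<close> on \<open>x\<close>.\<close>

lemma centre_imp_no_compl_centre:
  assumes uv: "f_twins V A u v" and c: "centre V A u v c"
    and xy: "f_twins V (- A) x y" and e: "centre V (- A) x y e"
  shows "c \<noteq> e"
proof
  assume ce: "c = e"
  have e': "\<not> A x c" "\<not> A c x" "\<not> A y c"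
    using centreD[OF e] ce by simp_all
  then have ne: "x \<noteq> u" "x \<noteq> v" "y \<noteq> u" 
    using centreD[OF c] by metis+
  have "A u x = A u c"
    using centre_eq[OF e, of u] ne ce f_twinsD(1)[OF uv] centreD(2)[OF c] by simp
  moreover have "A u x = A c x"
    using centre_eq[OF c, of x] ne ce f_twinsD(1)[OF xy] centreD(2)[OF e] by simp
  ultimately show False
    using e' centreD[OF c] by simp
qed

text \<open>Such an \<open>e\<close> is not joined to \<open>c\<close>. It agrees with
  \<open>c\<close> on \<open>u\<close>, so \<open>u\<close> is joined to it; but \<open>u\<close>
  agrees with \<open>c\<close> on \<open>e\<close>.\<close>

lemma centre_t_twin_no_compl_centre:
  assumes uv: "f_twins V A u v" and c: "centre V A u v c" and cd: "f_twins V (- A) c d"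
  shows "\<not> centre V (- A) c d e"
proof
  assume e: "centre V (- A) c d e"
  have e': "\<not> A c e" "e \<noteq> c" "e \<in> V"
    using centreD[OF e] by simp_all
  then have eu: "e \<noteq> u" "e \<noteq> v"
    using centreD[OF c] by metis+
  have du: "d \<noteq> u"
    using f_twins_eq(1)[OF cd, of v] f_twinsD[OF uv] centreD[OF c] by auto
  have "A c u = A e u" "A u c = A u e"
    using centre_eq[OF e, of u] f_twinsD(1)[OF uv] du eu(1) centreD(2)[OF c] by simp_all
  moreover have "A u e = A c e"
    using centre_eq[OF c, of e] e' eu by simp
  ultimately show False
    using centreD[OF c] e' by simp
qed

text \<open>Both centres copy \<open>u\<close> outside \<open>u\<close>, \<open>v\<close>, and
  \<open>u\<close> is joined to each of them.\<close>

lemma centres_t_twins: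
  assumes c: "centre V A u v c" and d: "centre V A u v d" and "c \<noteq> d"
  shows "f_twins V (- A) c d"
proof -
  have "A u d = A c d" "A d u = A d c"
    using centre_eq[OF c, of d] centreD[OF d] assms(3) by simp_all
  then have "A c d" "A d c"
    using centreD[OF d] by simp_all
  moreover have "A c w = A d w \<and> A w c = A w d" if w: "w \<in> V - {c, d}" for w
    using w centre_eq[OF c, of w] centre_eq[OF d, of w] centreD[OF c] centreD[OF d]
    by (cases "w = u \<or> w = v") auto
  ultimately show ?thesis
    using centreD(1)[OF c] centreD(1)[OF d] assms(3) by (simp add: f_twins_def)
qed

section \<open>Parts and twin classes in an obstruction\<close>

context obstruction
begin

text \<open>Otherwise \<open>v\<close> could join its twin \<open>u\<close> in an independent part,
  extending \<open>f\<close> to all of \<open>V\<close>.\<close>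

lemma f_twins_loop:
  assumes "f_twins V A u v" "full_hom I A H (V - {v}) f"
  shows "f u \<in> loops I H"
proof (rule ccontr)
  assume "f u \<notin> loops I H"
  moreover have uv: "u \<in> V" "v \<in> V" "u \<noteq> v" "\<not> A u v" "\<not> A v u"
    using assms by (auto simp: f_twins_def)
  moreover have fX: "f x \<in> I" if "x \<in> V" "x \<noteq> v" for x
    using assms that by (auto simp: full_hom_def)
  ultimately have nl: "\<not> H (f u) (f u)"
    by (auto simp: loops_def)
  have fA: "A x y = H (f x) (f y)" if "x \<in> V" "x \<noteq> v" "y \<in> V" "y \<noteq> v" "x \<noteq> y" for x y
    using assms that by (auto simp: full_hom_def)
  have "A x v = H (f x) (f u) \<and> A v x = H (f u) (f x)" if x: "x \<in> V" "x \<noteq> v" for x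
  proof (cases "x = u")
    case False
    then have "A x u = A x v" "A u x = A v x"
      using assms x by (auto simp: f_twins_def)
    then show ?thesis
      using fA[of x u] fA[of u x] x uv False by simp
  qed (use uv nl in auto)
  then have "full_hom I A H V (f(v := f u))"
    using fX fA uv by (auto simp: full_hom_def)
  then show False using no_hom by blast
qed

lemma f_class_inj:
  assumes "full_hom I A H (V - {v}) f"
  shows "inj_on f (f_class V A v - {v})"
proof (rule inj_onI, rule ccontr)
  fix x y assume *: "x \<in> f_class V A v - {v}" "y \<in> f_class V A v - {v}" "f x = f y" "x \<noteq> y"
  then have t: "f_twins V A x v" "f_twins V A y v"
    by (auto simp: f_class_def intro: f_twins_sym)
  have "f_twins V A x y"
    using f_twins_trans[OF t(1) f_twins_sym[OF t(2)] *(4)] .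
  moreover have "A x y = H (f x) (f y)"
    using full_homD[OF assms, of x y] f_twinsD[OF t(1)] f_twinsD[OF t(2)] *(4) by simp
  ultimately show False
    using f_twins_loop[OF t(1) assms] *(3) f_twinsD(4)[of V A x y] by (simp add: loops_def)
qed

lemma f_class_loops:
  assumes "full_hom I A H (V - {v}) f"
  shows "f ` (f_class V A v - {v}) \<subseteq> loops I H"
  using f_twins_loop[OF _ assms] by (auto simp: f_class_def intro: f_twins_sym)

lemma finite_loops: "finite (loops I H)" "finite (loops I (- H))"
  using finite_I by (auto simp: loops_def)

lemma card_f_class: 
  assumes "v \<in> V"
  shows "card (f_class V A v) \<le> card (loops I H) + 1"
proof -
  obtain f where f: "full_hom I A H (V - {v}) f" using hom_minus assms by blast
  have "card (f_class V A v - {v}) \<le> card (loops I H)"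
    using card_inj_on_le[OF f_class_inj[OF f] f_class_loops[OF f] finite_loops(1)] .
  then show ?thesis
    by (simp add: self_in_f_class card_Diff_singleton_if)
qed

lemma card_t_class: "v \<in> V \<Longrightarrow> card (f_class V (- A) v) \<le> card (loops I (- H)) + 1"
  by (rule obstruction.card_f_class) (simp_all add: obstruction_compl obstruction_axioms)

text \<open>\<open>v\<close> meets \<open>x\<close> and \<open>y\<close> as its twin
  \<open>u\<close> does, and \<open>u\<close> treats a part other than its own uniformly.\<close>

lemma same_part_twin_indist:
  assumes "f_twins V A u v" "full_hom I A H (V - {v}) f" "x \<in> V - {v}" "y \<in> V - {v}"
    and "f y = f x" "f u \<noteq> f x"
  shows "A x v = A y v \<and> A v x = A v y"
proof -
  have "u \<in> V - {v}" "x \<noteq> u" "y \<noteq> u"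
    using assms by (auto simp: f_twins_def)
  then show ?thesis
    using assms(3-5) f_twins_eq[OF assms(1), of x] f_twins_eq[OF assms(1), of y]
      full_homD[OF assms(2), of x u] full_homD[OF assms(2), of y u]
      full_homD[OF assms(2), of u x] full_homD[OF assms(2), of u y] by auto
qed

lemma nonloop_part_subset:
  assumes "f_twins V A u v" "full_hom I A H (V - {v}) f" "x \<in> V - {v}" "\<not> H (f x) (f x)"
  shows "{y \<in> V - {v}. f y = f x} \<subseteq> f_class V A x"
proof -
  have "f_twins V A x y" if y: "y \<in> V - {v}" "f y = f x" "y \<noteq> x" for y
  proof (rule same_part_f_twins[OF assms(2)])
    have "f u \<noteq> f x" using f_twins_loop[OF assms(1,2)] assms(4) by (auto simp: loops_def)
    then show "A x v = A y v \<and> A v x = A v y"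
      by (intro same_part_twin_indist[OF assms(1-3)]) (use y in auto)
  qed (use assms y in auto)
  then show ?thesis by (auto simp: f_class_def)
qed

lemma loop_part_subset:
  assumes "f_twins V A u v" "full_hom I A H (V - {v}) f" "x \<in> V - {v}" "H (f x) (f x)" "f x \<noteq> f u"
  shows "{y \<in> V - {v}. f y = f x} \<subseteq> f_class V (- A) x"
proof -
  have "f_twins V (- A) x y" if y: "y \<in> V - {v}" "f y = f x" "y \<noteq> x" for y
  proof (rule same_part_t_twins[OF assms(2)])
    show "A x v = A y v \<and> A v x = A v y"
      by (intro same_part_twin_indist[OF assms(1-3)]) (use y assms(5) in auto)
  qed (use assms y in auto)
  then show ?thesis by (auto simp: f_class_def)
qed

text \<open>In a common clique part \<open>x\<close> is joined to \<open>u\<close> and agrees with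
  it elsewhere; twinship carries adjacency over to \<open>v\<close>. A third class member would be
  joined to \<open>x\<close>, as \<open>v\<close> is, but not to \<open>u\<close>.\<close>

lemma shared_part_centre:
  assumes "f_twins V A u v" "full_hom I A H (V - {v}) f" "x \<in> V - {v}" "f x = f u" "x \<noteq> u"
  shows "centre V A u v x" "f_class V A v = {u, v}"
proof -
  have l: "H (f u) (f u)" using f_twins_loop[OF assms(1,2)] by (simp add: loops_def)
  have u: "u \<in> V - {v}"
    using assms(1) by (auto simp: f_twins_def)
  have ux: "A u x" "A x u"
    using full_homD[OF assms(2), of u x] full_homD[OF assms(2), of x u] u l assms(3-5) by auto
  then have vx: "A v x" "A x v"
    using f_twins_eq[OF assms(1), of x] assms(3,5) by auto
  have "A u w = A x w \<and> A w u = A w x" if "w \<in> V - {u, v, x}" for w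
    using that u assms(3-5) full_homD[OF assms(2), of u w] full_homD[OF assms(2), of x w]
      full_homD[OF assms(2), of w u] full_homD[OF assms(2), of w x] by auto
  then show c: "centre V A u v x"
    using ux vx assms(3,5) by (auto simp: centre_def)
  have "w = u" if "f_twins V A v w" for w
  proof (rule ccontr)
    assume "w \<noteq> u"
    then have "f_twins V A u w" using f_twins_trans[OF assms(1) that] by simp
    then have w: "w \<in> V" "w \<noteq> u" "w \<noteq> v" "\<not> A u w" "w \<noteq> x" "A x w"
      using that c f_twins_eq[OF that, of x] by (auto simp: f_twins_def centre_def)
    then show False
      using centre_eq[OF c, of w] by auto
  qed
  then show "f_class V A v = {u, v}"
    using assms(1) by (auto simp: f_class_def intro: f_twins_sym)
qed

section \<open>The count over a largest class of false twins\<close>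

lemma card_le_of_no_centre:
  assumes "v \<in> V" "f_class V A v \<noteq> {v}" 
    and max: "\<And>w. w \<in> V \<Longrightarrow> card (f_class V A w) \<le> card (f_class V A v)"
    and no_centre: "\<And>u c. f_class V A v = {u, v} \<Longrightarrow> \<not> centre V A u v c"
  shows "card V \<le> (card (loops I (- H)) + 1) * (card (loops I H) + 1)"
proof -
  obtain f where f: "full_hom I A H (V - {v}) f" using hom_minus assms by blast
  obtain u where u: "f_twins V A u v"
    using assms(2) by (auto simp: f_class_def intro: f_twins_sym)
  define J where "J = f ` (f_class V A v - {v})"
  define P where "P i = {x \<in> V - {v}. f x = i}" for i
  let ?k = "card (loops I (- H))" and ?l = "card (loops I H)" and ?m = "card (f_class V A v)"
  have finF: "finite (f_class V A w)" "finite (f_class V (- A) w)" if "w \<in> V" for w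
    using f_class_subset[OF that] finite_V finite_subset by metis+
  have JL: "J \<subseteq> loops I H" unfolding J_def by (rule f_class_loops[OF f])
  have "card J = card (f_class V A v - {v})"
    unfolding J_def by (rule card_image[OF f_class_inj[OF f]])
  then have cJ: "?m = card J + 1"
    using card_Suc_Diff1[OF finF(1)[OF assms(1)] self_in_f_class] by simp
  have cN: "card (P i) \<le> ?m" if i: "i \<in> loops I (- H)" for i
  proof (cases "P i = {}")
    case False
    then obtain x where x: "x \<in> V - {v}" "f x = i" by (auto simp: P_def)
    then have "P i \<subseteq> f_class V A x"
      using nonloop_part_subset[OF u f x(1)] i by (auto simp: P_def loops_def)
    then show ?thesis using card_mono[OF finF(1)] max x by (meson Diff_iff le_trans)
  qed simp
  have cL: "card (P i) \<le> ?k + 1" if i: "i \<in> loops I H - J" for i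
  proof (cases "P i = {}")
    case False
    then obtain x where x: "x \<in> V - {v}" "f x = i" by (auto simp: P_def)
    have "f u \<in> J" using u by (auto simp: J_def f_class_def f_twins_def intro: f_twins_sym)
    then have "f x \<noteq> f u" using i x by auto
    then have "P i \<subseteq> f_class V (- A) x"
      using loop_part_subset[OF u f x(1)] i x by (simp add: P_def loops_def)
    then show ?thesis using card_mono[OF finF(2)] card_t_class x by (meson Diff_iff le_trans)
  qed simp
  \<comment> \<open>The occupant \<open>w\<close> can play the role of \<open>u\<close>: a second
    vertex in its part would be a centre and force the class to be \<open>{w, v}\<close>, which
    \<open>no_centre\<close> excludes.\<close>
  have cS: "card (P i) \<le> 1" if i: "i \<in> J" for i
  proof -
    obtain w where w: "f_twins V A w v" "f w = i"
      using i by (auto simp: J_def f_class_def intro: f_twins_sym)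
    have "P i \<subseteq> {w}"
      using shared_part_centre[OF w(1) f] no_centre w(2) by (auto simp: P_def)
    then show ?thesis using card_mono[of "{w}"] by simp
  qed
  have I: "I = loops I (- H) \<union> loops I H" "loops I (- H) \<inter> loops I H = {}"
    by (auto simp: loops_def)
  have "card (V - {v}) \<le> (\<Sum>i\<in>I. card (P i))"
    unfolding P_def by (rule card_le_sum_parts) (use finite_V finite_I f in \<open>auto simp: full_hom_def\<close>)
  also have "\<dots> = (\<Sum>i\<in>loops I (- H). card (P i)) + (\<Sum>i\<in>loops I H. card (P i))"
    by (subst I(1)) (rule sum.union_disjoint[OF finite_loops(2,1) I(2)])
  also have "\<dots> = (\<Sum>i\<in>loops I (- H). card (P i)) + ((\<Sum>i\<in>loops I H - J. card (P i)) + (\<Sum>i\<in>J. card (P i)))"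
    by (simp only: sum.subset_diff[OF JL finite_loops(1), of "\<lambda>i. card (P i)"])
  also have "\<dots> \<le> ?k * ?m + (card (loops I H - J) * (?k + 1) + card J * 1)"
    by (intro add_mono sum_le_card_mult cN cL cS)
  finally have "card (V - {v}) \<le> ?k * ?m + (card (loops I H - J) * (?k + 1) + card J * 1)" .
  moreover have "?l = card (loops I H - J) + card J"
    using sum.subset_diff[OF JL finite_loops(1), of "\<lambda>_. 1 :: nat"] by simp
  moreover have "card V = card (V - {v}) + 1"
    using card_Suc_Diff1[OF finite_V assms(1)] by simp
  \<comment> \<open>As \<open>card J = m - 1\<close>, the terms in \<open>m\<close> cancel:
    \<open>m * (k + 1) + (l - m + 1) * (k + 1) = (l + 1) * (k + 1)\<close>.\<close>
  ultimately show ?thesis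
    using cJ by (simp add: algebra_simps)
qed

text \<open>A largest class with three or more members satisfies \<open>no_centre\<close> vacuously,
  so the count would contradict \<open>big\<close>.\<close>

lemma ex_centre:
  assumes big: "(card (loops I (- H)) + 1) * (card (loops I H) + 1) < card V"
  shows "w \<in> V \<Longrightarrow> card (f_class V A w) \<le> 2" and "f_twins V A u v \<Longrightarrow> \<exists>c. centre V A u v c"
proof -
  have fc: "u \<in> f_class V A v" "v \<in> f_class V A v" "v \<in> V" "u \<noteq> v" if "f_twins V A u v" for u v
    using that by (auto simp: f_class_def f_twins_def)
  have "V \<noteq> {}" using big by auto
  then obtain v0 where v0: "v0 \<in> V" "\<And>w. w \<in> V \<Longrightarrow> card (f_class V A w) \<le> card (f_class V A v0)"
    using finite_V Max_in[of "(\<lambda>w. card (f_class V A w)) ` V"] Max_ge[of "(\<lambda>w. card (f_class V A w)) ` V"]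
    by fastforce
  have le: "card (f_class V A v0) \<le> 2"
  proof (cases "f_class V A v0 = {v0}")
    case False
    then obtain u where "f_class V A v0 = {u, v0}"
      using card_le_of_no_centre[OF v0(1)] v0(2) big by force
    then show ?thesis by (simp add: card_insert_if)
  qed simp
  show two: "card (f_class V A w) \<le> 2" if "w \<in> V" for w
    using v0(2)[OF that] le by simp
  show "\<exists>c. centre V A u v c" if t: "f_twins V A u v"
  proof -
    have fin: "finite (f_class V A v)"
      using f_class_subset[of v V A] fc[OF t] finite_V finite_subset by metis
    have sub: "{u, v} \<subseteq> f_class V A v" using fc[OF t] by auto
    have "card {u, v} = 2" using fc[OF t] by simp
    then have eq: "f_class V A v = {u, v}"
      using card_seteq[OF fin sub] two[OF fc(3)[OF t]] by simp
    \<comment> \<open>A class of two elements is itself largest, so the count applies to every pair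
      of false twins.\<close>
    then have "card (f_class V A v) = 2" using fc[OF t] by simp
    then have max: "card (f_class V A w) \<le> card (f_class V A v)" if "w \<in> V" for w
      using two[OF that] by simp
    show ?thesis
    proof (rule ccontr)
      assume nc: "\<not> ?thesis"
      have "card V \<le> (card (loops I (- H)) + 1) * (card (loops I H) + 1)"
      proof (rule card_le_of_no_centre[OF fc(3)[OF t] _ max])
        show "f_class V A v \<noteq> {v}" using eq fc(4)[OF t] by auto
        fix u' c assume "f_class V A v = {u', v}"
        then have "u' = u" using eq fc(4)[OF t] by (auto simp: doubleton_eq_iff)
        then show "\<not> centre V A u' v c" using nc by blast
      qed
      then show False using big by simp
    qed
  qed
qed


section \<open>The exceptional case\<close>

lemma centre_no_twins:
  assumes big: "(card (loops I (- H)) + 1) * (card (loops I H) + 1) < card V"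
    and c: "f_twins V A u v" "centre V A u v c"
  shows "\<not> f_twins V A c d" "\<not> f_twins V (- A) c d"
proof -
  interpret co: obstruction V I "- A" "- H"
    using obstruction_compl obstruction_axioms .
  show "\<not> f_twins V A c d" using centre_no_f_twin[OF c(2)] f_twinsD(1)[OF c(1)] .
  \<comment> \<open>The bound is symmetric under complementation, so a true twin \<open>d\<close> of
    \<open>c\<close> would yield a centre in the complement.\<close>
  show "\<not> f_twins V (- A) c d"
    using co.ex_centre(2)[of c d] centre_t_twin_no_compl_centre[OF c] big by (auto simp: mult.commute)
qed

text \<open>Over \<open>V - {v}\<close> every part has at most two vertices and that of
  \<open>z\<close> only one; restoring \<open>v\<close> gives
  \<open>1 + 1 + 2 * (k + l - 1)\<close>.\<close>

lemma card_le_of_twinless: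
  assumes big: "(card (loops I (- H)) + 1) * (card (loops I H) + 1) < card V"
    and uv: "f_twins V A u v" and c: "centre V A u v c"
    and z: "z \<in> V - {u, v, c}" "\<And>d. \<not> f_twins V A z d" "\<And>d. \<not> f_twins V (- A) z d"
  shows "card V \<le> 2 * (card (loops I (- H)) + card (loops I H))"
proof -
  interpret co: obstruction V I "- A" "- H"
    using obstruction_compl obstruction_axioms .
  have v: "v \<in> V" using uv by (simp add: f_twins_def)
  obtain f where f: "full_hom I A H (V - {v}) f" using hom_minus v by blast
  define P where "P i = {x \<in> V - {v}. f x = i}" for i
  have fin: "finite (f_class V B w)" if "w \<in> V" for B w
    using f_class_subset[OF that] finite_V finite_subset by metis
  \<comment> \<open>Another vertex here would be a second centre of \<open>u\<close>,
    \<open>v\<close>, hence a true twin of \<open>c\<close>.\<close>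
  have u: "P (f u) \<subseteq> {u, c}"
    using shared_part_centre(1)[OF uv f] centres_t_twins[OF c] centre_no_twins(2)[OF big uv c]
    by (fastforce simp: P_def)
  have part: "P (f x) \<subseteq> f_class V A x \<or> P (f x) \<subseteq> f_class V (- A) x" if "x \<in> V - {v}" "f x \<noteq> f u" for x
    using nonloop_part_subset[OF uv f that(1)] loop_part_subset[OF uv f that(1)] that(2)
    unfolding P_def by blast
  have two: "card (P i) \<le> 2" for i
  proof (cases "P i = {} \<or> i = f u")
    case True
    then show ?thesis
      using card_mono[OF _ u] card_insert_le_m1[of 2 "{c}" u] by auto
  next
    case False
    then obtain x where x: "x \<in> V - {v}" "f x = i" "f x \<noteq> f u" by (auto simp: P_def)
    have "card (f_class V A x) \<le> 2" "card (f_class V (- A) x) \<le> 2"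
      using ex_centre(1)[OF big, of x] co.ex_centre(1)[of x] big x(1) by (auto simp: mult.commute)
    then show ?thesis
      using part[OF x(1,3)] card_mono[OF fin] x by (metis DiffD1 le_trans)
  qed
  have "f z \<noteq> f u" using u z(1) by (auto simp: P_def)
  then have "P (f z) \<subseteq> {z}" 
    using part[of z] z by (auto simp: f_class_def)
  then have one: "card (P (f z)) \<le> 1"
    using card_mono[of "{z}"] by simp
  have fz: "f z \<in> I" using f z(1) by (auto simp: full_hom_def)
  have I: "loops I (- H) \<union> loops I H = I" "loops I (- H) \<inter> loops I H = {}"
    by (auto simp: loops_def)
  have cI: "card I = card (loops I (- H)) + card (loops I H)"
    using card_Un_disjoint[OF finite_loops(2,1) I(2)] I(1) by simp
  have "card (V - {v}) \<le> (\<Sum>i\<in>I. card (P i))"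
    unfolding P_def by (rule card_le_sum_parts) (use finite_V finite_I f in \<open>auto simp: full_hom_def\<close>)
  also have "\<dots> = card (P (f z)) + (\<Sum>i\<in>I - {f z}. card (P i))"
    using finite_I fz by (rule sum.remove)
  also have "\<dots> \<le> 1 + card (I - {f z}) * 2"
    by (intro add_mono one sum_le_card_mult two)
  finally have "card V - 1 \<le> 1 + (card I - 1) * 2"
    using v fz finite_V by (simp add: card_Diff_singleton_if)
  moreover have "card I > 0" using fz finite_I card_gt_0_iff by blast
  ultimately have "card V \<le> 2 * card I" by arith
  then show ?thesis using cI by simp
qed

text \<open>Such a \<open>c\<close> distinguishes nothing, so each part over \<open>V - {c}\<close>
  lies in a twin class.\<close>

lemma card_le_of_dominating_vertex:
  assumes c: "c \<in> V" "\<And>w. w \<in> V - {c} \<Longrightarrow> A c w \<and> A w c"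
    and two: "\<And>w. w \<in> V \<Longrightarrow> card (f_class V A w) \<le> 2"
    and no_t: "\<And>x y. \<not> f_twins V (- A) x y"
  shows "card V \<le> 2 * card (loops I (- H)) + card (loops I H) + 1"
proof -
  obtain f where f: "full_hom I A H (V - {c}) f" using hom_minus c(1) by blast
  define P where "P i = {x \<in> V - {c}. f x = i}" for i
  have fin: "finite (f_class V B w)" if "w \<in> V" for B w
    using f_class_subset[OF that] finite_V finite_subset by metis
  have N: "card (P i) \<le> 2" if i: "i \<in> loops I (- H)" for i
  proof (cases "P i = {}")
    case False
    then obtain x where x: "x \<in> V - {c}" "f x = i" by (auto simp: P_def)
    have "P i \<subseteq> f_class V A x"
      using same_part_f_twins[OF f x(1)] x i c(2) by (auto simp: P_def loops_def f_class_def)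
    then show ?thesis using card_mono[OF fin] two x by (metis DiffD1 le_trans)
  qed simp
  have L: "card (P i) \<le> 1" if i: "i \<in> loops I H" for i
  proof (cases "P i = {}")
    case False
    then obtain x where x: "x \<in> V - {c}" "f x = i" by (auto simp: P_def)
    have "P i \<subseteq> {x}"
      using same_part_t_twins[OF f x(1)] x i c(2) no_t by (fastforce simp: P_def loops_def)
    then show ?thesis using card_mono[of "{x}"] by simp
  qed simp
  have I: "I = loops I (- H) \<union> loops I H" "loops I (- H) \<inter> loops I H = {}"
    by (auto simp: loops_def)
  have "card (V - {c}) \<le> (\<Sum>i\<in>I. card (P i))"
    unfolding P_def by (rule card_le_sum_parts) (use finite_V finite_I f in \<open>auto simp: full_hom_def\<close>)
  also have "\<dots> = (\<Sum>i\<in>loops I (- H). card (P i)) + (\<Sum>i\<in>loops I H. card (P i))"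
    by (subst I(1)) (rule sum.union_disjoint[OF finite_loops(2,1) I(2)])
  also have "\<dots> \<le> card (loops I (- H)) * 2 + card (loops I H) * 1"
    by (intro add_mono sum_le_card_mult N L)
  finally show ?thesis
    using c(1) finite_V by (simp add: card_Diff_singleton_if)
qed

text \<open>This settles \<open>k = 0\<close>, where the estimate \<open>2 * (k + l)\<close> of
  \<open>card_le_of_twinless\<close> can exceed the bound.\<close>

lemma card_le_of_no_nonloops:
  assumes uv: "f_twins V A u v" and c: "centre V A u v c" and k: "loops I (- H) = {}"
  shows "card V \<le> card (loops I H) + 1"
proof -
  have no_t: "\<not> f_twins V (- A) x y" for x y
  proof
    assume t: "f_twins V (- A) x y"
    then have x: "x \<in> V" "x \<noteq> y" "{x, y} \<subseteq> f_class V (- A) x"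
      by (auto simp: f_twins_def f_class_def)
    then have "finite (f_class V (- A) x)"
      using f_class_subset[OF x(1)] finite_V finite_subset by metis
    then show False
      using card_mono[OF _ x(3)] card_t_class[OF x(1)] k x(2) by simp
  qed
  have V: "c \<in> V" "u \<in> V" "v \<in> V" "u \<noteq> v" "c \<noteq> u" "c \<noteq> v" "\<not> A u v" "\<not> A v u"
    using uv c by (auto simp: f_twins_def centre_def)
  obtain f where f: "full_hom I A H (V - {c}) f" using hom_minus V(1) by blast
  have fL: "f ` (V - {c}) \<subseteq> loops I H"
    using f k by (auto simp: full_hom_def loops_def)
  \<comment> \<open>A vertex \<open>x\<close> in the part of \<open>w\<close> is joined to
    \<open>w\<close>, hence to its twin \<open>w'\<close>; then \<open>w\<close>, sharing the part
    of \<open>x\<close>, would be joined to \<open>w'\<close> too.\<close>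
  have alone: "f x \<noteq> f w" if x: "x \<in> V - {c}" "x \<noteq> w" and w: "w = u \<or> w = v" for x w
  proof
    assume eq: "f x = f w"
    obtain w' where w': "{w, w'} = {u, v}" "w \<noteq> w'" using w V(4) by auto
    then have fw: "f_twins V A w w'" "w \<in> V - {c}" "w' \<in> V - {c}" "\<not> A w w'"
      using uv V by (auto simp: doubleton_eq_iff intro: f_twins_sym)
    have loop: "H (f w) (f w)" using fL fw(2) by (auto simp: loops_def)
    then have "A x w" "A w x"
      using full_homD[OF f, of x w] full_homD[OF f, of w x] x fw eq by auto
    moreover from this have "x \<noteq> w'" using fw(4) by auto
    ultimately have "A x w'"
      using f_twins_eq[OF fw(1), of x] x by auto
    then have "A w w'"
      using full_homD[OF f, of x w'] full_homD[OF f, of w w'] x fw eq w'(2) \<open>x \<noteq> w'\<close> by auto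
    then show False using fw(4) by simp
  qed
  have "inj_on f (V - {c})"
  proof (rule inj_onI, rule ccontr)
    fix x y assume xy: "x \<in> V - {c}" "y \<in> V - {c}" "f x = f y" "x \<noteq> y"
    then have ne: "x \<noteq> u" "x \<noteq> v" "y \<noteq> u" "y \<noteq> v"
      using alone[of x y] alone[of y x] by auto
    have "A x u = A y u" "A u x = A u y"
      using full_homD[OF f, of x u] full_homD[OF f, of y u] full_homD[OF f, of u x] full_homD[OF f, of u y]
        xy ne V by auto
    \<comment> \<open>Towards \<open>x\<close> and \<open>y\<close> the deleted vertex
      \<open>c\<close> behaves like \<open>u\<close>, so it does not distinguish them.\<close>
    then have "A x c = A y c \<and> A c x = A c y"
      using centre_eq[OF c, of x] centre_eq[OF c, of y] xy ne by auto
    then have "f_twins V (- A) x y"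
      using same_part_t_twins[OF f xy(1,2,4,3)] fL xy by (auto simp: loops_def)
    then show False using no_t by blast
  qed
  then have "card (V - {c}) \<le> card (loops I H)"
    using card_inj_on_le fL finite_loops(1) by blast
  then show ?thesis using V(1) finite_V by (simp add: card_Diff_singleton_if)
qed

theorem card_le_of_f_twins:
  assumes uv: "f_twins V A u v"
  shows "card V \<le> (card (loops I (- H)) + 1) * (card (loops I H) + 1)"
proof (rule ccontr)
  let ?k = "card (loops I (- H))" and ?l = "card (loops I H)"
  assume "\<not> ?thesis"
  then have big: "(?k + 1) * (?l + 1) < card V" by simp
  interpret co: obstruction V I "- A" "- H"
    using obstruction_compl obstruction_axioms .
  have co_big: "(card (loops I (- (- H))) + 1) * (?k + 1) < card V"
    using big by (simp add: mult.commute)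
  obtain c where c: "centre V A u v c" using ex_centre(2)[OF big uv] ..
  obtain f where "full_hom I A H (V - {v}) f" using hom_minus uv by (auto simp: f_twins_def)
  then have "loops I H \<noteq> {}" using f_twins_loop[OF uv] by auto
  then have l: "?l \<ge> 1" using finite_loops(1) by (simp add: Suc_leI card_gt_0_iff)
  have "loops I (- H) \<noteq> {}" using card_le_of_no_nonloops[OF uv c] big by auto
  then have k: "?k \<ge> 1" using finite_loops(2) by (simp add: Suc_leI card_gt_0_iff)
  \<comment> \<open>For \<open>k, l >= 1\<close> both remaining estimates contradict
    \<open>big\<close>: \<open>(k + 1) * (l + 1) - 2 * (k + l) = (k - 1) * (l - 1)\<close>, and
    \<open>2 * k + l + 1\<close> is within the bound since \<open>k <= k * l\<close>.\<close>
  obtain k' l' where kl: "?k = Suc k'" "?l = Suc l'"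
    using k l by (metis One_nat_def Suc_le_D)
  have no_z: "\<exists>d. f_twins V A z d \<or> f_twins V (- A) z d" if "z \<in> V - {c}" for z
  proof (cases "z = u \<or> z = v")
    case False
    then show ?thesis
      using card_le_of_twinless[OF big uv c, of z] that big kl by fastforce
  qed (use uv f_twins_sym in metis)
  \<comment> \<open>A complementary centre differs from \<open>c\<close>, so it has a twin by
    \<open>no_z\<close>; yet centres have none.\<close>
  have no_t: "\<not> f_twins V (- A) x y" for x y
  proof
    assume xy: "f_twins V (- A) x y"
    then obtain e where e: "centre V (- A) x y e" using co.ex_centre(2)[OF co_big] by blast
    then have "e \<in> V - {c}"
      using centre_imp_no_compl_centre[OF uv c xy e] by (auto simp: centre_def)
    then show False using no_z co.centre_no_twins[OF co_big xy e] by auto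
  qed
  \<comment> \<open>The centre of \<open>w\<close> and its false twin has no twins, and only
    \<open>c\<close> can lack them.\<close>
  have c_adj: "A c w \<and> A w c" if w: "w \<in> V - {c}" for w
  proof -
    obtain d where d: "f_twins V A w d" using no_z[OF w] no_t by blast
    obtain e where e: "centre V A w d e" using ex_centre(2)[OF big d] ..
    then have "e = c"
      using no_z[of e] centre_no_twins[OF big d e] by (auto simp: centre_def)
    then show ?thesis using e by (auto simp: centre_def)
  qed
  have "card V \<le> 2 * ?k + ?l + 1"
    by (rule card_le_of_dominating_vertex[of c])
       (use c c_adj ex_centre(1)[OF big] no_t in \<open>auto simp: centre_def\<close>)
  then show False using big kl by simp
qed

end


section \<open>From matrix partitions to full homomorphisms\<close>

lemma is_M_partition_imp_full_hom:
  assumes "is_M_partition M G W" and entries: "\<And>i j. i < dim_row M \<Longrightarrow> j < dim_row M \<Longrightarrow> M $$ (i, j) \<in> {0, 1}"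
  shows "full_hom {..<dim_row M} (\<lambda>x y. x \<rightarrow>\<^bsub>G\<^esub> y) (\<lambda>i j. M $$ (i, j) = 1) (verts G)
    (\<lambda>x. SOME i. i < dim_row M \<and> x \<in> W i)"
proof -
  define f where "f x = (SOME i. i < dim_row M \<and> x \<in> W i)" for x
  have f: "f x < dim_row M" "x \<in> W (f x)" if "x \<in> verts G" for x
  proof -
    have "\<exists>i. i < dim_row M \<and> x \<in> W i"
      using assms(1) that by (auto simp: is_M_partition_def)
    from someI_ex[OF this] show "f x < dim_row M" "x \<in> W (f x)"
      by (simp_all add: f_def)
  qed
  have "x \<rightarrow>\<^bsub>G\<^esub> y \<longleftrightarrow> M $$ (f x, f y) = 1" if xy: "x \<in> verts G" "y \<in> verts G" "x \<noteq> y" for x y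
  proof (cases "f x = f y")
    case True
    have "independent_set G (W (f x)) \<or> M $$ (f x, f x) \<noteq> 0"
      "strong_clique G (W (f x)) \<or> M $$ (f x, f x) \<noteq> 1"
      using assms(1) f(1)[OF xy(1)] by (auto simp: is_M_partition_def)
    then show ?thesis
      using True xy(3) f[OF xy(1)] f[OF xy(2)] entries[of "f x" "f x"]
      by (auto simp: independent_set_def strong_clique_def)
  next
    case False
    then have "completely_nonadjacent G (W (f x)) (W (f y)) \<or> M $$ (f x, f y) \<noteq> 0"
      "completely_adjacent G (W (f x)) (W (f y)) \<or> M $$ (f x, f y) \<noteq> 1"
      using assms(1) f(1)[OF xy(1)] f(1)[OF xy(2)] by (auto simp: is_M_partition_def)
    then show ?thesis
      using f[OF xy(1)] f[OF xy(2)] entries[of "f x" "f y"]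
      by (auto simp: completely_nonadjacent_def completely_adjacent_def)
  qed
  then show ?thesis
    using f(1) unfolding f_def[symmetric] by (auto simp: full_hom_def)
qed

text \<open>\<open>independent_set\<close> also concerns pairs \<open>(x, x)\<close>, on which
  \<open>full_hom\<close> is silent; looplessness of \<open>G\<close> covers them.\<close>

lemma full_hom_imp_is_M_partition:
  assumes "full_hom {..<dim_row M} (\<lambda>x y. x \<rightarrow>\<^bsub>G\<^esub> y) (\<lambda>i j. M $$ (i, j) = 1) (verts G) f"
    and "\<And>x. \<not> x \<rightarrow>\<^bsub>G\<^esub> x"
  shows "is_M_partition M G (\<lambda>i. {x \<in> verts G. f x = i})"
proof -
  have adj: "M $$ (f x, f y) = 1" if "x \<rightarrow>\<^bsub>G\<^esub> y" "x \<in> verts G" "y \<in> verts G" for x y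
  proof -
    have "x \<noteq> y" using that(1) assms(2) by auto
    then show ?thesis using full_homD[OF assms(1) that(2,3)] that(1) by simp
  qed
  have arc: "x \<rightarrow>\<^bsub>G\<^esub> y" if "M $$ (f x, f y) = 1" "x \<in> verts G" "y \<in> verts G" "x \<noteq> y" for x y
    using full_homD[OF assms(1) that(2,3,4)] that(1) by simp
  have f: "f x < dim_row M" if "x \<in> verts G" for x
    using assms(1) that by (auto simp: full_hom_def)
  show ?thesis
    unfolding is_M_partition_def disjoint_family_on_def independent_set_def strong_clique_def
      completely_nonadjacent_def completely_adjacent_def
    using f by (auto dest: adj intro: arc)
qed

lemma del_vert_adj:
  "x \<noteq> v \<Longrightarrow> y \<noteq> v \<Longrightarrow> x \<rightarrow>\<^bsub>pre_digraph.del_vert G v\<^esub> y \<longleftrightarrow> x \<rightarrow>\<^bsub>G\<^esub> y"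
  by (auto simp: arcs_ends_def arc_to_ends_def pre_digraph.del_vert_def)

lemma square_binary_entries:
  assumes "square_mat M" "elements_mat M \<subseteq> {0, 1}" "i < dim_row M" "j < dim_row M"
  shows "M $$ (i, j) \<in> {0, 1}"
proof -
  have "M $$ (i, j) \<in> elements_mat M"
    by (rule elements_matI[of M "dim_row M" "dim_row M"]) (use assms in auto)
  then show ?thesis using assms(2) by blast
qed

lemma obstruction_of_minimal_M_obstruction:
  assumes "square_mat M" "elements_mat M \<subseteq> {0, 1}" "minimal_M_obstruction M D"
  shows "obstruction (verts D) {..<dim_row M} (\<lambda>x y. x \<rightarrow>\<^bsub>D\<^esub> y) (\<lambda>i j. M $$ (i, j) = 1)"
proof
  interpret digraph D using assms(3) by (simp add: minimal_M_obstruction_def)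
  have entries: "M $$ (i, j) \<in> {0, 1}" if "i < dim_row M" "j < dim_row M" for i j
    using square_binary_entries[OF assms(1,2) that] .
  show "finite (verts D)" "finite {..<dim_row M}" by simp_all
  show "\<not> full_hom {..<dim_row M} (\<lambda>x y. x \<rightarrow>\<^bsub>D\<^esub> y) (\<lambda>i j. M $$ (i, j) = 1) (verts D) f" for f
    using full_hom_imp_is_M_partition[of M D f] adj_not_same assms(3)
    by (auto simp: minimal_M_obstruction_def has_M_partition_def)
  fix v assume "v \<in> verts D"
  then obtain W where W: "is_M_partition M (del_vert v) W"
    using assms(3) by (auto simp: minimal_M_obstruction_def has_M_partition_def)
  show "\<exists>f. full_hom {..<dim_row M} (\<lambda>x y. x \<rightarrow>\<^bsub>D\<^esub> y) (\<lambda>i j. M $$ (i, j) = 1) (verts D - {v}) f"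
    using is_M_partition_imp_full_hom[OF W entries]
    by (auto simp: full_hom_def del_vert_adj verts_del_vert)
qed

theorem theorem3:
  fixes M :: "nat mat" and D :: "('a, 'b) pre_digraph" and k l :: nat
  assumes "square_mat M"
    and "elements_mat M \<subseteq> {0, 1}"
    and "card {i. i < dim_row M \<and> M $$ (i, i) = 0} = k"
    and "card {i. i < dim_row M \<and> M $$ (i, i) = 1} = l"
    and "minimal_M_obstruction M D"
    and "(\<exists>u v. false_twins D u v) \<or> (\<exists>u v. true_twins D u v)"
  shows "card (verts D) \<le> (k + 1) * (l + 1)"
proof -
  let ?A = "\<lambda>x y. x \<rightarrow>\<^bsub>D\<^esub> y" and ?H = "\<lambda>i j. M $$ (i, j) = 1" and ?I = "{..<dim_row M}"
  interpret obs: obstruction "verts D" ?I ?A ?H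
    using assms(1,2,5) by (rule obstruction_of_minimal_M_obstruction)
  interpret co: obstruction "verts D" ?I "- ?A" "- ?H"
    by (rule obstruction_compl) (rule obs.obstruction_axioms)
  have entries: "M $$ (i, i) = 0 \<longleftrightarrow> M $$ (i, i) \<noteq> 1" if "i < dim_row M" for i
    using square_binary_entries[OF assms(1,2) that that] by auto
  have "loops ?I (- ?H) = {i. i < dim_row M \<and> M $$ (i, i) = 0}"
    using entries by (auto simp: loops_def)
  then have k: "card (loops ?I (- ?H)) = k" using assms(3) by simp
  have "loops ?I ?H = {i. i < dim_row M \<and> M $$ (i, i) = 1}"
    by (auto simp: loops_def)
  then have l: "card (loops ?I ?H) = l" using assms(4) by simp
  from assms(6) show ?thesis
  proof
    assume "\<exists>u v. false_twins D u v"
    then obtain u v where "f_twins (verts D) ?A u v"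
      by (auto simp: false_twins_def twins_def distinguishes_def f_twins_def)
    then show ?thesis
      using obs.card_le_of_f_twins k l by simp
  next
    assume "\<exists>u v. true_twins D u v"
    then obtain u v where "f_twins (verts D) (- ?A) u v"
      by (auto simp: true_twins_def twins_def distinguishes_def f_twins_def)
    then show ?thesis
      \<comment> \<open>In the complement \<open>k\<close> and \<open>l\<close> trade places, which
        leaves the product unchanged.\<close>
      using co.card_le_of_f_twins k l by (simp add: algebra_simps)
  qed
qed

end
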